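(* Let $\mathcal{P}_3=\{S^m \mid m\in\mathbb{N}\}$. Then $\mathcal{N}^{cell}(\mathcal{P}_3)$ is the class of finite groups.
   Context: Cellular actions: a group $G$ acts cellularly on a CW-complex $X$ if it acts by homeomorphisms permuting the open cells, and the stabilizer of any cell fixes that cell pointwise. The class $\mathcal{N}^{cell}(\mathcal{P})$: for a class $\mathcal{P}$ of finite dimensional CW-complexes, $\mathcal{N}^{cell}(\mathcal{P})$ is the smallest class of groups containing the trivial group with the property that if a group $G$ acts cellularly on some $X\in\mathcal{P}$ such that all isotropy groups are in $\mathcal{N}^{cell}(\mathcal{P})$, then $G$ is in $\mathcal{N}^{cell}(\mathcal{P})$. $\mathbb{N}$ is the set of positive integers, and the spheres listed in $\mathcal{P}_3$ are allowed to carry any CW-structure. *)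

theory Defs
  imports "HOL-Analysis.Analysis" "HOL-Algebra.Group_Action" "HOL-Algebra.Elementary_Groups"
begin

definition closed_disc :: "nat \<Rightarrow> (nat \<Rightarrow> real) set" where
  "closed_disc n = {x \<in> topspace (Euclidean_space n). (\<Sum>i<n. x i ^ 2) \<le> 1}"

definition open_disc :: "nat \<Rightarrow> (nat \<Rightarrow> real) set" where
  "open_disc n = {x \<in> topspace (Euclidean_space n). (\<Sum>i<n. x i ^ 2) < 1}"

text \<open>
  A cell decomposition is given by the family \<open>E\<close>, where \<open>E n\<close> is the set of open \<open>n\<close>-cells.
\<close>

definition cells :: "(nat \<Rightarrow> 'x set set) \<Rightarrow> 'x set set" where
  "cells E = (\<Union>n. E n)"

text \<open>
  \<open>f\<close> is a characteristic map for the open \<open>n\<close>-cell \<open>e\<close>. The last clause (closure-finiteness)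
  is empty for \<open>n = 0\<close>, where the open and the closed disc are the same point.
\<close>

definition characteristic_map ::
    "'x topology \<Rightarrow> (nat \<Rightarrow> 'x set set) \<Rightarrow> nat \<Rightarrow> 'x set \<Rightarrow> ((nat \<Rightarrow> real) \<Rightarrow> 'x) \<Rightarrow> bool" where
  "characteristic_map X E n e f \<longleftrightarrow>
     continuous_map (subtopology (Euclidean_space n) (closed_disc n)) X f \<and>
     homeomorphic_map (subtopology (Euclidean_space n) (open_disc n)) (subtopology X e) f \<and>
     (\<exists>F. finite F \<and> F \<subseteq> (\<Union>k<n. E k) \<and> f ` (closed_disc n - open_disc n) \<subseteq> \<Union>F)"

text \<open>
  Whitehead's definition. Characteristic maps are required to exist but are not part of the
  structure: a cellular action only has to respect the open cells. The disjointness clause also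
  says that no set is a cell of two different dimensions.
\<close>

definition cw_complex :: "'x topology \<Rightarrow> (nat \<Rightarrow> 'x set set) \<Rightarrow> bool" where
  "cw_complex X E \<longleftrightarrow>
     Hausdorff_space X \<and>
     \<Union>(cells E) = topspace X \<and>
     (\<forall>m n d e. d \<in> E m \<and> e \<in> E n \<and> (m, d) \<noteq> (n, e) \<longrightarrow> d \<inter> e = {}) \<and>
     (\<forall>n. \<forall>e\<in>E n. \<exists>f. characteristic_map X E n e f) \<and>
     (\<forall>A\<subseteq>topspace X. (\<forall>e\<in>cells E. closedin X (A \<inter> X closure_of e)) \<longrightarrow> closedin X A)"

definition finite_dim_cw_complex :: "'x topology \<Rightarrow> (nat \<Rightarrow> 'x set set) \<Rightarrow> bool" where
  "finite_dim_cw_complex X E \<longleftrightarrow> cw_complex X E \<and> (\<exists>N. \<forall>n>N. E n = {})"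

definition cellular_action ::
    "'g monoid \<Rightarrow> 'x topology \<Rightarrow> (nat \<Rightarrow> 'x set set) \<Rightarrow> ('g \<Rightarrow> 'x \<Rightarrow> 'x) \<Rightarrow> bool" where
  "cellular_action G X E \<phi> \<longleftrightarrow>
     group_action G (topspace X) \<phi> \<and>
     (\<forall>g\<in>carrier G. homeomorphic_map X X (\<phi> g)) \<and>
     (\<forall>g\<in>carrier G. bij_betw (\<lambda>e. \<phi> g ` e) (cells E) (cells E)) \<and>
     (\<forall>e\<in>cells E. \<forall>g\<in>carrier G. \<phi> g ` e = e \<longrightarrow> (\<forall>x\<in>e. \<phi> g x = x))"

text \<open>
  The part of the class consisting of the groups with elements in \<open>'g\<close>. Since isotropy groups
  are subgroups of the group acting, membership never refers to groups over other types.
  \<open>P\<close> is meant to be a class of finite dimensional CW-complexes.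
\<close>

inductive_set Ncell :: "('x topology \<times> (nat \<Rightarrow> 'x set set)) set \<Rightarrow> 'g monoid set"
  for P :: "('x topology \<times> (nat \<Rightarrow> 'x set set)) set" where
  trivial: "trivial_group G \<Longrightarrow> G \<in> Ncell P"
| action: "\<lbrakk>group G; (X, E) \<in> P; cellular_action G X E \<phi>;
            \<forall>x\<in>topspace X. G\<lparr>carrier := stabilizer G \<phi> x\<rparr> \<in> Ncell P\<rbrakk> \<Longrightarrow> G \<in> Ncell P"

definition P3 :: "((nat \<Rightarrow> real) topology \<times> (nat \<Rightarrow> (nat \<Rightarrow> real) set set)) set" where
  "P3 = {(X, E). cw_complex X E \<and> (\<exists>m>0. X = nsphere m)}"

text \<open>Finite dimensionality is automatic, because spheres are compact.\<close>

lemma compactin_closed_disc: "compactin (Euclidean_space n) (closed_disc n)"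
proof -
  let ?B = "{x :: nat \<Rightarrow> real. \<forall>i. x i \<in> (if i < n then {-1..1} else {0})}"
  have B: "?B = (\<Pi>\<^sub>E i\<in>UNIV. (if i < n then {-1..1} else {0}))" by (auto simp: PiE_def Pi_def)
  have cB: "compactin (powertop_real UNIV) ?B"
    unfolding B by (subst compactin_PiE) auto
  have sub: "closed_disc n \<subseteq> ?B"
  proof
    fix x assume x: "x \<in> closed_disc n"
    have "x i \<in> {-1..1}" if "i < n" for i
    proof -
      have "x i ^ 2 \<le> (\<Sum>i<n. x i ^ 2)" using that by (intro member_le_sum[where f = "\<lambda>i. x i ^ 2"]) auto
      then have "x i ^ 2 \<le> 1" using x by (simp add: closed_disc_def)
      then show ?thesis using abs_square_le_1[of "x i"] by (auto simp: abs_le_iff)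
    qed
    then show "x \<in> ?B" using x by (auto simp: closed_disc_def topspace_Euclidean_space)
  qed
  have "closedin (powertop_real UNIV) {x \<in> topspace (powertop_real UNIV). (\<Sum>i<n. x i ^ 2) \<in> {..1::real}}"
    by (intro closedin_continuous_map_preimage[where Y = euclideanreal] continuous_map_sum
        continuous_map_real_pow continuous_map_product_projection) auto
  moreover have "closedin (powertop_real UNIV) {x::nat \<Rightarrow> real. \<forall>i\<ge>n. x i = 0}"
    using closedin_Euclidean_space[of n] by (simp add: topspace_Euclidean_space)
  moreover have "closed_disc n =
      {x \<in> topspace (powertop_real UNIV). (\<Sum>i<n. x i ^ 2) \<in> {..1::real}} \<inter> {x. \<forall>i\<ge>n. x i = 0}"
    by (auto simp: closed_disc_def topspace_Euclidean_space)
  ultimately have cl: "closedin (powertop_real UNIV) (closed_disc n)" by auto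
  have "compactin (powertop_real UNIV) (closed_disc n)"
    using closed_compactin[OF cB sub cl] .
  moreover have "closed_disc n \<subseteq> {x. \<forall>i\<ge>n. x i = 0}"
    by (auto simp: closed_disc_def topspace_Euclidean_space)
  ultimately show ?thesis by (simp add: Euclidean_space_def compactin_subtopology)
qed

lemma compact_space_nsphere: "compact_space (nsphere n)"
proof -
  have "closedin (Euclidean_space (Suc n))
      {x \<in> topspace (Euclidean_space (Suc n)). (\<Sum>i\<le>n. x i ^ 2) \<in> {1::real}}"
    unfolding Euclidean_space_def
    by (intro closedin_continuous_map_preimage[where Y = euclideanreal] continuous_map_sum
        continuous_map_real_pow continuous_map_from_subtopology continuous_map_product_projection) auto
  then have "compactin (Euclidean_space (Suc n))
      {x \<in> topspace (Euclidean_space (Suc n)). (\<Sum>i\<le>n. x i ^ 2) \<in> {1::real}}"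
    by (rule closed_compactin[OF compactin_closed_disc[of "Suc n"], rotated])
       (auto simp: closed_disc_def lessThan_Suc_atMost)
  then show ?thesis
    using compact_space_subtopology subtopology_restrict[of "Euclidean_space (Suc n)" "{x. (\<Sum>i\<le>n. x i ^ 2) = 1}"]
    by (fastforce simp: nsphere_def Int_def)
qed

lemma compact_cw_complex_finite_cells:
  assumes cw: "cw_complex X E" and comp: "compact_space X"
  shows "finite (cells E)"
proof -
  have haus: "Hausdorff_space X" and cover: "\<Union>(cells E) = topspace X"
    using cw by (simp_all add: cw_complex_def)
  have disj: "d \<inter> e = {}" if "d \<in> E m" "e \<in> E n" "(m, d) \<noteq> (n, e)" for m n d e
    using cw that unfolding cw_complex_def by meson
  have char: "\<exists>f. characteristic_map X E n e f" if "e \<in> E n" for n e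
    using cw that unfolding cw_complex_def by meson
  have weak: "closedin X A" if "A \<subseteq> topspace X" "\<forall>e\<in>cells E. closedin X (A \<inter> X closure_of e)" for A
    using cw that unfolding cw_complex_def by meson
  have disj': "d = e" if "d \<in> cells E" "e \<in> cells E" "x \<in> d" "x \<in> e" for d e x
    using that disj unfolding cells_def by fastforce
  have fin_closure: "\<exists>F. finite F \<and> F \<subseteq> cells E \<and> X closure_of e \<subseteq> \<Union>F" and nonempty: "e \<noteq> {}"
    if e: "e \<in> cells E" for e
  proof -
    obtain n where n: "e \<in> E n" using e by (auto simp: cells_def)
    obtain f where f: "characteristic_map X E n e f" using char[OF n] by blast
    then obtain F where F: "finite F" "F \<subseteq> (\<Union>k<n. E k)" "f ` (closed_disc n - open_disc n) \<subseteq> \<Union>F"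
      unfolding characteristic_map_def by blast
    have esub: "e \<subseteq> topspace X" using cover e by blast
    have cont: "continuous_map (subtopology (Euclidean_space n) (closed_disc n)) X f"
      and hom: "homeomorphic_map (subtopology (Euclidean_space n) (open_disc n)) (subtopology X e) f"
      using f by (auto simp: characteristic_map_def)
    have "f ` open_disc n = e"
    proof -
      have "topspace (Euclidean_space n) \<inter> open_disc n = open_disc n" by (auto simp: open_disc_def)
      then show ?thesis
        using homeomorphic_imp_surjective_map[OF hom] esub
        by (simp add: Int_absorb1 Int_absorb2 inf.commute)
    qed
    moreover have "open_disc n \<noteq> {}"
    proof -
      have "(\<lambda>i. 0) \<in> open_disc n" by (simp add: open_disc_def topspace_Euclidean_space)
      then show ?thesis by blast
    qed
    ultimately show "e \<noteq> {}" by blast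
    have "compactin (Euclidean_space n) (closed_disc n)" by (rule compactin_closed_disc)
    then have "compactin X (f ` closed_disc n)"
      by (intro image_compactin[OF _ cont]) (simp add: compactin_subtopology)
    then have "closedin X (f ` closed_disc n)" using compactin_imp_closedin[OF haus] by blast
    moreover have "open_disc n \<subseteq> closed_disc n" by (auto simp: open_disc_def closed_disc_def)
    ultimately have "X closure_of e \<subseteq> f ` closed_disc n"
      using \<open>f ` open_disc n = e\<close> by (intro closure_of_minimal) auto
    also have "\<dots> \<subseteq> \<Union>(insert e F)" using F(3) \<open>f ` open_disc n = e\<close> by auto
    finally show "\<exists>F. finite F \<and> F \<subseteq> cells E \<and> X closure_of e \<subseteq> \<Union>F"
    proof (intro exI[of _ "insert e F"] conjI)
      show "insert e F \<subseteq> cells E" using F(2) e unfolding cells_def by blast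
    qed (use F(1) in auto)
  qed
  obtain p where p: "\<And>e. e \<in> cells E \<Longrightarrow> p e \<in> e"
    using nonempty by (metis ex_in_conv)
  have inj: "inj_on p (cells E)" using p disj' by (metis inj_onI)
  have closed: "closedin X A" if A: "A \<subseteq> p ` cells E" for A
  proof (rule weak)
    show AX: "A \<subseteq> topspace X" using A p cover by blast
    show "\<forall>e\<in>cells E. closedin X (A \<inter> X closure_of e)"
    proof
      fix e assume e: "e \<in> cells E"
      obtain F where F: "finite F" "F \<subseteq> cells E" "X closure_of e \<subseteq> \<Union>F"
        using fin_closure[OF e] by (elim exE conjE) (rule that)
      have "A \<inter> X closure_of e \<subseteq> p ` F"
      proof
        fix x assume x: "x \<in> A \<inter> X closure_of e"
        then obtain c where c: "c \<in> cells E" "x = p c" using A by blast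
        obtain d where d: "d \<in> F" "x \<in> d" using x F(3) by blast
        have "c = d" using disj'[OF c(1) subsetD[OF F(2) d(1)] _ d(2)] p[OF c(1)] c(2) by simp
        then show "x \<in> p ` F" using c d by blast
      qed
      then have "finite (A \<inter> X closure_of e)" using F(1) by (meson finite_imageI finite_subset)
      then show "closedin X (A \<inter> X closure_of e)"
        using AX haus by (intro closedin_Hausdorff_finite) auto
    qed
  qed
  have "subtopology X (p ` cells E) = discrete_topology (p ` cells E)"
  proof -
    have "openin (subtopology X (p ` cells E)) U" if "U \<subseteq> p ` cells E" for U
    proof -
      have "closedin (subtopology X (p ` cells E)) (p ` cells E - U)"
        using closed[of "p ` cells E - U"] by (intro closedin_subset_topspace) auto
      then have "openin (subtopology X (p ` cells E))
          (topspace (subtopology X (p ` cells E)) - (p ` cells E - U))" by blast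
      moreover have "topspace (subtopology X (p ` cells E)) = p ` cells E"
        using closed[of "p ` cells E"] closedin_subset by fastforce
      ultimately show ?thesis using that by (simp add: double_diff)
    qed
    moreover have "U \<subseteq> p ` cells E" if "openin (subtopology X (p ` cells E)) U" for U
      using that openin_subset by fastforce
    ultimately show ?thesis by (auto simp: topology_eq)
  qed
  moreover have "compactin X (p ` cells E)"
    using closed comp closedin_compact_space by blast
  ultimately have "finite (p ` cells E)"
    by (metis compact_space_subtopology compact_space_discrete_topology)
  then show ?thesis using inj finite_imageD by blast
qed

lemma P3_finite_dim:
  assumes "(X, E) \<in> P3" shows "finite_dim_cw_complex X E"
proof -
  have cw: "cw_complex X E" and "compact_space X"
    using assms compact_space_nsphere by (auto simp: P3_def)
  then have fin: "finite (cells E)" by (rule compact_cw_complex_finite_cells)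
  have nonempty: "e \<noteq> {}" if "e \<in> E n" for e n
  proof
    assume "e = {}"
    have "\<exists>f. characteristic_map X E n e f" using cw that unfolding cw_complex_def by meson
    then obtain f where "homeomorphic_map (subtopology (Euclidean_space n) (open_disc n)) (subtopology X e) f"
      unfolding characteristic_map_def by blast
    from homeomorphic_imp_surjective_map[OF this]
    have "topspace (Euclidean_space n) \<inter> open_disc n = {}" using \<open>e = {}\<close> by simp
    moreover have "(\<lambda>i. 0) \<in> topspace (Euclidean_space n) \<inter> open_disc n"
      by (simp add: open_disc_def topspace_Euclidean_space)
    ultimately show False by blast
  qed
  have uniq: "m = n" if "e \<in> E m" "e \<in> E n" for e m n
    proof (rule ccontr)
    assume "m \<noteq> n"
    then have "e \<inter> e = {}" using cw that unfolding cw_complex_def by (meson Pair_inject)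
    then show False using nonempty[OF that(1)] by simp
  qed
  have "{n. E n \<noteq> {}} \<subseteq> (\<lambda>e. THE n. e \<in> E n) ` cells E"
  proof
    fix n assume "n \<in> {n. E n \<noteq> {}}"
    then obtain e where e: "e \<in> E n" by blast
    then have "(THE n. e \<in> E n) = n" using uniq by blast
    then show "n \<in> (\<lambda>e. THE n. e \<in> E n) ` cells E" using e by (force simp: cells_def)
  qed
  then have "finite {n. E n \<noteq> {}}" using fin finite_surj by blast
  then obtain N where "\<forall>n\<in>{n. E n \<noteq> {}}. n \<le> N" using finite_nat_set_iff_bounded_le by blast
  then have "\<forall>n>N. E n = {}" using linorder_not_less by auto
  then show ?thesis using cw by (auto simp: finite_dim_cw_complex_def)
qed

end

theory Submission
  imports Defs
begin

text \<open>
  A sphere is compact, so a CW-structure on it has finitely many cells. In a cellular action the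
  elements that preserve the cell of a point fix the point, so the group is covered by finitely many
  cosets of an isotropy group (\<open>finite_if_cellular_action\<close>), and finiteness passes from the isotropy
  groups to the group.

  Conversely, a nontrivial finite group \<open>G\<close> needs a cellular action on a sphere of positive dimension
  without a global fixed point: its isotropy groups are then proper subgroups, and induction on the
  order applies (\<open>finite_group_in_Ncell\<close>). Take the regular representation modulo the constant
  vectors. It has no nonzero fixed vector, since a vector fixed modulo constants by a permutation of its
  finitely many values is fixed exactly, and \<open>G\<close> is transitive on the coordinates. Rays in this quotient
  form a sphere of dimension \<open>|G| - 2\<close>. This is too small when \<open>|G| = 2\<close>, where the
  antipodal map of the circle is used instead.

  Both actions are cellular for the same CW-structure, the Coxeter complex of type A: two vectors lie in
  the same open cell if their coordinates are ordered in the same way, ties included. A permutation of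
  the coordinates that preserves the order pattern of a vector fixes the vector
  (\<open>same_order_comp_imp_eq\<close>), which is the condition on stabilizers of cells. A vector with \<open>k + 2\<close>
  distinct values is given, up to scaling and constants, by \<open>k + 1\<close> positive gaps, hence by a point of
  an open \<open>k\<close>-simplex, and a gap that vanishes on the boundary of the simplex leads to a cell of lower
  dimension (\<open>characteristic_map_order_cell\<close>).
\<close>

section \<open>Order patterns and the sphere of sequences modulo constants\<close>

text \<open>
  A point of the unit sphere in \<open>\<real>\<^sup>m\<close> is a sequence vanishing from \<open>m\<close> on. The entry at \<open>m\<close> serves
  as the last of \<open>m + 1\<close> coordinates that matter only up to a common constant.
\<close>

definition usphere :: "nat \<Rightarrow> (nat \<Rightarrow> real) set" where
  "usphere m = {y. (\<forall>i\<ge>m. y i = 0) \<and> (\<Sum>i<m. (y i)\<^sup>2) = 1}"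

definition nonconst :: "nat \<Rightarrow> (nat \<Rightarrow> real) set" where
  "nonconst m = {z. (\<forall>i\<ge>m. z i = z m) \<and> (\<exists>i. z i \<noteq> z m)}"

text \<open>
  The representative on the sphere of a vector that is given up to a positive factor and an
  additive constant.
\<close>

definition normalize_at :: "nat \<Rightarrow> (nat \<Rightarrow> real) \<Rightarrow> nat \<Rightarrow> real" where
  "normalize_at m z = (\<lambda>i. (z i - z m) / L2_set (\<lambda>i. z i - z m) {..<m})"

definition same_order :: "(nat \<Rightarrow> real) \<Rightarrow> (nat \<Rightarrow> real) \<Rightarrow> bool" where
  "same_order y z \<longleftrightarrow> (\<forall>i j. y i < y j \<longleftrightarrow> z i < z j)"

lemma nsphere_eq_usphere: "nsphere p = top_of_set (usphere (Suc p))"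
  unfolding nsphere usphere_def euclidean_product_topology
  by (rule arg_cong[where f = "subtopology euclidean"])
     (auto simp: Suc_le_eq lessThan_Suc_atMost)

lemma nonconst_tail: "z \<in> nonconst m \<Longrightarrow> m \<le> i \<Longrightarrow> z i = z m"
  unfolding nonconst_def by blast

lemma L2_set_pos_nonconst:
  assumes "z \<in> nonconst m"
  shows "L2_set (\<lambda>i. z i - z m) {..<m} > 0"
proof -
  obtain i where "z i \<noteq> z m" using assms unfolding nonconst_def by blast
  moreover have "i < m" using calculation nonconst_tail[OF assms] not_less by blast
  ultimately have "L2_set (\<lambda>i. z i - z m) {..<m} \<noteq> 0"
    by (subst L2_set_eq_0_iff) auto
  then show ?thesis using L2_set_nonneg[of "\<lambda>i. z i - z m" "{..<m}"] by linarith
qed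

lemma normalize_at_affine:
  assumes "z \<in> nonconst m"
  obtains a b where "a > 0" "normalize_at m z = (\<lambda>i. a * z i + b)"
proof
  let ?L = "L2_set (\<lambda>i. z i - z m) {..<m}"
  show "1 / ?L > 0" using L2_set_pos_nonconst[OF assms] by simp
  show "normalize_at m z = (\<lambda>i. 1 / ?L * z i + - z m / ?L)"
    by (simp add: normalize_at_def diff_divide_distrib)
qed

lemma normalize_at_affine_image:
  assumes "a > 0"
  shows "normalize_at m (\<lambda>i. a * z i + b) = normalize_at m z"
proof -
  have "L2_set (\<lambda>i. a * z i - a * z m) {..<m} = a * L2_set (\<lambda>i. z i - z m) {..<m}"
    using assms by (simp add: L2_set_right_distrib right_diff_distrib)
  then show ?thesis using assms
    by (simp add: normalize_at_def flip: right_diff_distrib)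
qed

lemma normalize_at_usphere:
  assumes "z \<in> nonconst m"
  shows "normalize_at m z \<in> usphere m"
proof -
  let ?L = "L2_set (\<lambda>i. z i - z m) {..<m}"
  have "?L > 0" using assms by (rule L2_set_pos_nonconst)
  have "(\<Sum>i<m. ((z i - z m) / ?L)\<^sup>2) = (\<Sum>i<m. (z i - z m)\<^sup>2) / ?L\<^sup>2"
    by (simp add: power_divide sum_divide_distrib)
  also have "(\<Sum>i<m. (z i - z m)\<^sup>2) = ?L\<^sup>2"
    by (simp add: L2_set_def sum_nonneg)
  finally have "(\<Sum>i<m. ((z i - z m) / ?L)\<^sup>2) = 1" using \<open>?L > 0\<close> by simp
  moreover have "(z i - z m) / ?L = 0" if "i \<ge> m" for i
    using nonconst_tail[OF assms that] by simp
  ultimately show ?thesis unfolding usphere_def normalize_at_def by blast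
qed

lemma normalize_at_id:
  assumes "y \<in> usphere m"
  shows "normalize_at m y = y"
proof -
  have "y m = 0" "L2_set y {..<m} = 1" using assms by (auto simp: usphere_def L2_set_def)
  then show ?thesis by (simp add: normalize_at_def)
qed

lemma usphere_subset_nonconst: "usphere m \<subseteq> nonconst m"
proof
  fix y assume y: "y \<in> usphere m"
  have "\<exists>i. y i \<noteq> 0"
  proof (rule ccontr)
    assume "\<nexists>i. y i \<noteq> 0"
    then show False using y by (simp add: usphere_def)
  qed
  then show "y \<in> nonconst m" using y by (auto simp: usphere_def nonconst_def)
qed

lemma continuous_on_coordinate [continuous_intros]:
  fixes S :: "('a \<Rightarrow> 'b::topological_space) set"
  shows "continuous_on S (\<lambda>x. x i)"
  by (rule continuous_on_subset[OF continuous_on_product_coordinates]) simp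

lemma continuous_on_normalize_at: "continuous_on (nonconst m) (normalize_at m)"
proof -
  have "sqrt (\<Sum>i<m. (z i - z m)\<^sup>2) \<noteq> 0" if "z \<in> nonconst m" for z
    using L2_set_pos_nonconst[OF that] by (simp add: L2_set_def)
  then show ?thesis
    unfolding normalize_at_def L2_set_def
    by (intro continuous_intros) auto
qed

lemma same_order_refl [simp]: "same_order y y"
  by (simp add: same_order_def)

lemma same_order_sym: "same_order y z \<Longrightarrow> same_order z y"
  by (simp add: same_order_def)

lemma same_order_trans: "same_order x y \<Longrightarrow> same_order y z \<Longrightarrow> same_order x z"
  by (simp add: same_order_def)

lemma same_order_affine: "a > 0 \<Longrightarrow> same_order z (\<lambda>i. a * z i + b)"
  by (simp add: same_order_def)

lemma same_order_normalize_at: "z \<in> nonconst m \<Longrightarrow> same_order z (normalize_at m z)"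
  by (erule normalize_at_affine) (simp add: same_order_affine)

lemma same_order_eq_iff:
  assumes "same_order y z"
  shows "y i = y j \<longleftrightarrow> z i = z j"
proof -
  have "y i < y j \<longleftrightarrow> z i < z j" "y j < y i \<longleftrightarrow> z j < z i"
    using assms by (simp_all add: same_order_def)
  then show ?thesis by linarith
qed

lemma same_order_card_range:
  assumes "same_order y z"
  shows "card (range y) = card (range z)"
proof -
  define g where "g v = z (SOME i. y i = v)" for v
  have g: "g (y i) = z i" for i
    unfolding g_def by (rule someI2[of _ i]) (simp_all add: same_order_eq_iff[OF assms])
  have "inj_on g (range y)" by (auto simp: inj_on_def g same_order_eq_iff[OF assms])
  moreover have "g ` range y = range z" by (simp add: image_image g)
  ultimately show ?thesis by (metis card_image)
qed

lemma finite_range_nonconst: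
  assumes "z \<in> nonconst m"
  shows "finite (range z)"
proof -
  have "z i \<in> z ` {..m}" for i
    using nonconst_tail[OF assms, of i] by (cases "i \<le> m") auto
  then have "range z \<subseteq> z ` {..m}" by blast
  then show ?thesis using finite_surj by blast
qed

text \<open>
  This is the reason why the cells below have pointwise fixed stabilizers: were \<open>z (t i)\<close> larger
  than \<open>z i\<close>, then \<open>z\<close> would increase strictly along the orbit of \<open>i\<close> under \<open>t\<close> and so take infinitely
  many values.
\<close>

lemma same_order_comp_imp_eq:
  fixes t :: "nat \<Rightarrow> nat"
  assumes fin: "finite (range z)" and ord: "same_order (z \<circ> t) z"
  shows "z \<circ> t = z"
proof -
  have iter: "\<not> (\<forall>n. f n < f (Suc n))" if "\<And>n. f n \<in> range z" for f :: "nat \<Rightarrow> real"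
  proof
    assume "\<forall>n. f n < f (Suc n)"
    then have "inj f" by (intro strict_mono_imp_inj_on) (simp add: strict_mono_Suc_iff)
    then show False using fin that finite_subset[of "range f" "range z"]
      by (metis finite_imageD image_subsetI infinite_UNIV_nat)
  qed
  have step: "z (t i) < z (t j) \<longleftrightarrow> z i < z j" for i j
    using ord by (simp add: same_order_def)
  have "z (t i) = z i" for i
  proof (rule ccontr)
    assume ne: "z (t i) \<noteq> z i"
    consider "z i < z (t i)" | "z (t i) < z i" using ne by linarith
    then show False
    proof cases
      case 1
      have "z ((t ^^ n) i) < z ((t ^^ Suc n) i)" for n
        by (induction n) (use 1 step in auto)
      then show False using iter[of "\<lambda>n. z ((t ^^ n) i)"] by blast
    next
      case 2
      have dec: "z ((t ^^ Suc n) i) < z ((t ^^ n) i)" for n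
        by (induction n) (use 2 step in auto)
      then have "inj (\<lambda>n. - z ((t ^^ n) i))"
        by (intro strict_mono_imp_inj_on) (simp add: strict_mono_Suc_iff)
      then have "inj (\<lambda>n. z ((t ^^ n) i))" by (simp add: inj_on_def)
      moreover have "range (\<lambda>n. z ((t ^^ n) i)) \<subseteq> range z" by blast
      ultimately show False using fin by (metis finite_imageD finite_subset infinite_UNIV_nat)
    qed
  qed
  then show ?thesis by auto
qed

lemma rank_exists:
  fixes y :: "nat \<Rightarrow> real"
  assumes fin: "finite (range y)"
  obtains r :: "nat \<Rightarrow> nat"
  where "range r = {..<card (range y)}" "\<And>i j. r i < r j \<longleftrightarrow> y i < y j"
proof -
  define c where "c v = card {w \<in> range y. w < v}" for v
  have mono: "c v < c w" if "v \<in> range y" "v < w" for v w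
    unfolding c_def using that fin by (intro psubset_card_mono) auto
  have iff: "c (y i) < c (y j) \<longleftrightarrow> y i < y j" for i j
    using mono[of "y i" "y j"] mono[of "y j" "y i"]
    by (metis linorder_less_linear order_less_asym rangeI)
  have "inj_on c (range y)"
    by (rule inj_onI) (metis iff imageE linorder_less_linear order_less_irrefl)
  then have "card (c ` range y) = card (range y)" by (rule card_image)
  moreover have "c ` range y \<subseteq> {..<card (range y)}"
    unfolding c_def using fin by (auto intro!: psubset_card_mono)
  ultimately have "c ` range y = {..<card (range y)}"
    by (intro card_subset_eq) auto
  then have "range (c \<circ> y) = {..<card (range y)}" by (simp add: image_comp)
  then show thesis using iff by (intro that[of "c \<circ> y"]) auto
qed

section \<open>Radial maps between convex bodies\<close>

text \<open>
  The rescaling that turns \<open>p\<close> into \<open>q\<close> along rays. At the origin the quotient is not continuous, but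
  the bound on the coordinates lets \<open>p\<close> itself control the product.
\<close>

lemma continuous_on_radial:
  fixes p q :: "(nat \<Rightarrow> real) \<Rightarrow> real"
  assumes p: "continuous_on U p" and q: "continuous_on U q"
    and p0: "p (\<lambda>_. 0) = 0"
    and pos: "\<And>x. x \<in> U \<Longrightarrow> x \<noteq> (\<lambda>_. 0) \<Longrightarrow> q x > 0"
    and bound: "\<And>x i. x \<in> U \<Longrightarrow> \<bar>x i\<bar> \<le> C * q x"
  shows "continuous_on U (\<lambda>x i. p x / q x * x i)"
proof (rule continuous_on_coordinatewise_then_product)
  fix i
  show "continuous_on U (\<lambda>x. p x / q x * x i)"
    unfolding continuous_on_def
  proof
    fix x assume x: "x \<in> U"
    have lim: "(p \<longlongrightarrow> p x) (at x within U)" "(q \<longlongrightarrow> q x) (at x within U)"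
      "((\<lambda>x. x i) \<longlongrightarrow> x i) (at x within U)"
      using p q continuous_on_coordinate[of U i] x by (auto simp: continuous_on_def)
    show "((\<lambda>x. p x / q x * x i) \<longlongrightarrow> p x / q x * x i) (at x within U)"
    proof (cases "x = (\<lambda>_. 0)")
      case False
      then have "q x \<noteq> 0" using pos[OF x] by simp
      then show ?thesis by (intro tendsto_intros lim)
    next
      case True
      have le: "norm (p x' / q x' * x' i) \<le> C * \<bar>p x'\<bar>" if x': "x' \<in> U" "x' \<noteq> x" for x'
      proof -
        have qpos: "q x' > 0" using pos that True by simp
        have "norm (p x' / q x' * x' i) = \<bar>p x'\<bar> * (\<bar>x' i\<bar> / q x')"
          using qpos by (simp add: abs_mult)
        also have "\<dots> \<le> \<bar>p x'\<bar> * C"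
          using bound[OF x'(1), of i] qpos by (intro mult_left_mono) (auto simp: field_simps)
        finally show ?thesis by (simp add: mult.commute)
      qed
      have "((\<lambda>x. C * \<bar>p x\<bar>) \<longlongrightarrow> C * \<bar>p x\<bar>) (at x within U)"
        by (intro tendsto_intros lim)
      then have "((\<lambda>x. C * \<bar>p x\<bar>) \<longlongrightarrow> 0) (at x within U)" using True p0 by simp
      then have "((\<lambda>x. p x / q x * x i) \<longlongrightarrow> 0) (at x within U)"
        by (rule Lim_null_comparison[rotated])
           (use le in \<open>auto simp: eventually_at_filter\<close>)
      then show ?thesis using True by simp
    qed
  qed
qed

text \<open>
  The difference \<open>1 - facet j x\<close> is the gap between the entries \<open>j\<close> and \<open>j + 1\<close> of \<open>levels x\<close>, so
  that the maximum \<open>gauge k x\<close> of the facet functions is at most \<open>1\<close> exactly if the entries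
  \<open>0, \<dots>, k + 1\<close> increase weakly. This is a simplex around the origin of \<open>\<real>\<^sup>k\<close>.
\<close>

definition levels :: "(nat \<Rightarrow> real) \<Rightarrow> nat \<Rightarrow> real" where
  "levels x j = real j + (case j of 0 \<Rightarrow> 0 | Suc i \<Rightarrow> x i)"

definition facet :: "nat \<Rightarrow> (nat \<Rightarrow> real) \<Rightarrow> real" where
  "facet j x = (case j of 0 \<Rightarrow> 0 | Suc i \<Rightarrow> x i) - x j"

fun gauge_upto :: "nat \<Rightarrow> (nat \<Rightarrow> real) \<Rightarrow> real" where
  "gauge_upto 0 x = facet 0 x"
| "gauge_upto (Suc j) x = max (gauge_upto j x) (facet (Suc j) x)"

lemma levels_gap: "levels x (Suc j) - levels x j = 1 - facet j x"
  by (simp add: levels_def facet_def split: nat.split)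

lemma gauge_le_iff: "gauge_upto k x \<le> c \<longleftrightarrow> (\<forall>j\<le>k. facet j x \<le> c)"
  by (induction k) (auto simp: le_Suc_eq)

lemma gauge_less_iff: "gauge_upto k x < c \<longleftrightarrow> (\<forall>j\<le>k. facet j x < c)"
  by (induction k) (auto simp: le_Suc_eq)

lemma facet_scale: "facet j (\<lambda>i. a * x i) = a * facet j x"
  by (simp add: facet_def right_diff_distrib split: nat.split)

lemma gauge_scale: "a \<ge> 0 \<Longrightarrow> gauge_upto k (\<lambda>i. a * x i) = a * gauge_upto k x"
  by (induction k) (simp_all add: facet_scale max_mult_distrib_left)

lemma continuous_on_gauge: "continuous_on U (gauge_upto k)"
proof (induction k)
  case 0
  have "continuous_on U (facet 0)" unfolding facet_def by (auto intro!: continuous_intros)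
  then show ?case by (simp add: gauge_upto.simps(1)[abs_def])
next
  case (Suc k)
  have "continuous_on U (facet (Suc k))" unfolding facet_def by (auto intro!: continuous_intros)
  with Suc have "continuous_on U (\<lambda>x. max (gauge_upto k x) (facet (Suc k) x))"
    by (intro continuous_on_max)
  then show ?case by simp
qed

definition coord_space :: "nat \<Rightarrow> (nat \<Rightarrow> real) set" where
  "coord_space k = {x. \<forall>i\<ge>k. x i = 0}"

text \<open>
  The facet functions telescope: those numbered \<open>0, \<dots>, j\<close> sum up to \<open>- x j\<close> and those numbered
  \<open>j + 1, \<dots>, k\<close> to \<open>x j\<close>, and none of them exceeds the gauge.
\<close>

lemma gauge_bound:
  assumes x: "x \<in> coord_space k"
  shows "\<bar>x i\<bar> \<le> real (Suc k) * gauge_upto k x"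
proof -
  let ?q = "gauge_upto k x"
  have f: "facet j x \<le> ?q" if "j \<le> k" for j
    using gauge_le_iff[of k x ?q] that by simp
  have lower: "- x j \<le> real (Suc j) * ?q" if "j \<le> k" for j
    using that
  proof (induction j)
    case 0
    then show ?case using f[of 0] by (simp add: facet_def)
  next
    case (Suc j)
    then show ?case using f[of "Suc j"] by (simp add: facet_def algebra_simps)
  qed
  have upper: "x (k - d) \<le> real d * ?q" if "d \<le> k" for d
    using that
  proof (induction d)
    case 0
    then show ?case using x by (simp add: coord_space_def)
  next
    case (Suc d)
    then have eq: "k - d = Suc (k - Suc d)" by simp
    have "facet (k - d) x = x (k - Suc d) - x (k - d)" by (simp add: facet_def eq)
    then have "x (k - Suc d) \<le> x (k - d) + ?q" using f[of "k - d"] by simp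
    also have "\<dots> \<le> real (Suc d) * ?q" using Suc by (simp add: algebra_simps)
    finally show ?case .
  qed
  have "0 \<le> real (Suc k) * ?q" using lower[of k] x by (simp add: coord_space_def)
  then have q: "0 \<le> ?q" by (simp add: zero_le_mult_iff)
  show ?thesis
  proof (cases "i < k")
    case True
    have "real (Suc i) * ?q \<le> real (Suc k) * ?q" using True q by (intro mult_right_mono) auto
    moreover have "real (k - i) * ?q \<le> real (Suc k) * ?q" using True q by (intro mult_right_mono) auto
    ultimately show ?thesis using lower[of i] upper[of "k - i"] True by simp
  next
    case False
    then show ?thesis using x q by (simp add: coord_space_def)
  qed
qed

lemma gauge_pos:
  assumes "x \<in> coord_space k" "x \<noteq> (\<lambda>_. 0)"
  shows "gauge_upto k x > 0"
proof -
  obtain i where "x i \<noteq> 0" using assms(2) by blast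
  then have "0 < real (Suc k) * gauge_upto k x"
    using gauge_bound[OF assms(1), of i] by linarith
  then show ?thesis by (simp add: zero_less_mult_iff)
qed

lemma L2_pos_coord_space:
  assumes "x \<in> coord_space k" "x \<noteq> (\<lambda>_. 0)"
  shows "L2_set x {..<k} > 0"
proof -
  obtain i where i: "x i \<noteq> 0" using assms(2) by blast
  then have "i < k" using assms(1) by (auto simp: coord_space_def not_less[symmetric])
  with i have "L2_set x {..<k} \<noteq> 0" by (subst L2_set_eq_0_iff) auto
  then show ?thesis using L2_set_nonneg[of x "{..<k}"] by linarith
qed

lemma L2_bound_coord_space: "x \<in> coord_space k \<Longrightarrow> \<bar>x i\<bar> \<le> 1 * L2_set x {..<k}"
  using member_le_L2_set[of "{..<k}" i "\<lambda>i. \<bar>x i\<bar>"]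
  by (cases "i < k") (auto simp: coord_space_def L2_set_def sum_nonneg)

text \<open>The homeomorphism of \<open>\<real>\<^sup>k\<close> that maps the unit disc to the simplex along rays.\<close>

definition disc_to_simplex :: "nat \<Rightarrow> (nat \<Rightarrow> real) \<Rightarrow> nat \<Rightarrow> real" where
  "disc_to_simplex k x = (\<lambda>i. L2_set x {..<k} / gauge_upto k x * x i)"

definition simplex_to_disc :: "nat \<Rightarrow> (nat \<Rightarrow> real) \<Rightarrow> nat \<Rightarrow> real" where
  "simplex_to_disc k x = (\<lambda>i. gauge_upto k x / L2_set x {..<k} * x i)"

lemma continuous_on_L2: "continuous_on U (\<lambda>x. L2_set x {..<k})"
  unfolding L2_set_def by (intro continuous_intros)

lemma gauge_zero: "gauge_upto k (\<lambda>_. 0) = 0"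
  using gauge_scale[of 0 k "\<lambda>_. 0"] by simp

lemma continuous_on_disc_to_simplex: "continuous_on (coord_space k) (disc_to_simplex k)"
  unfolding disc_to_simplex_def
  by (rule continuous_on_radial[OF continuous_on_L2 continuous_on_gauge _ gauge_pos gauge_bound])
     (auto simp: L2_set_def)

lemma continuous_on_simplex_to_disc: "continuous_on (coord_space k) (simplex_to_disc k)"
  unfolding simplex_to_disc_def
  by (rule continuous_on_radial[OF continuous_on_gauge continuous_on_L2 _ L2_pos_coord_space L2_bound_coord_space])
     (auto simp: gauge_zero)

lemma gauge_nonneg: "x \<in> coord_space k \<Longrightarrow> gauge_upto k x \<ge> 0"
  using gauge_pos[of x k] gauge_zero[of k] by (cases "x = (\<lambda>_. 0)") auto

lemma gauge_disc_to_simplex: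
  assumes "x \<in> coord_space k"
  shows "gauge_upto k (disc_to_simplex k x) = L2_set x {..<k}"
proof (cases "x = (\<lambda>_. 0)")
  case True
  then show ?thesis by (simp add: disc_to_simplex_def gauge_zero L2_set_def)
next
  case False
  then show ?thesis using gauge_pos[OF assms] unfolding disc_to_simplex_def
    by (subst gauge_scale) auto
qed

lemma L2_simplex_to_disc:
  assumes "x \<in> coord_space k"
  shows "L2_set (simplex_to_disc k x) {..<k} = gauge_upto k x"
proof (cases "x = (\<lambda>_. 0)")
  case True
  then show ?thesis by (simp add: simplex_to_disc_def gauge_zero L2_set_def)
next
  case False
  then show ?thesis using L2_pos_coord_space[OF assms] gauge_nonneg[OF assms] unfolding simplex_to_disc_def
    by (subst L2_set_right_distrib[symmetric]) auto
qed

lemma simplex_to_disc_inverse: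
  assumes "x \<in> coord_space k"
  shows "simplex_to_disc k (disc_to_simplex k x) = x"
proof (cases "x = (\<lambda>_. 0)")
  case True
  then show ?thesis by (simp add: simplex_to_disc_def disc_to_simplex_def)
next
  case False
  note pos = gauge_pos[OF assms False] L2_pos_coord_space[OF assms False]
  have L: "L2_set (disc_to_simplex k x) {..<k} = L2_set x {..<k} / gauge_upto k x * L2_set x {..<k}"
    unfolding disc_to_simplex_def using pos by (subst L2_set_right_distrib) auto
  show ?thesis
    unfolding simplex_to_disc_def gauge_disc_to_simplex[OF assms] L
    using pos by (simp add: disc_to_simplex_def)
qed

lemma disc_to_simplex_inverse:
  assumes "x \<in> coord_space k"
  shows "disc_to_simplex k (simplex_to_disc k x) = x"
proof (cases "x = (\<lambda>_. 0)")
  case True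
  then show ?thesis by (simp add: simplex_to_disc_def disc_to_simplex_def)
next
  case False
  note pos = gauge_pos[OF assms False] L2_pos_coord_space[OF assms False]
  have G: "gauge_upto k (simplex_to_disc k x) = gauge_upto k x / L2_set x {..<k} * gauge_upto k x"
    unfolding simplex_to_disc_def using pos by (subst gauge_scale) auto
  show ?thesis
    unfolding disc_to_simplex_def L2_simplex_to_disc[OF assms] G
    using pos by (simp add: simplex_to_disc_def)
qed

lemma radial_coord_space:
  "x \<in> coord_space k \<Longrightarrow> disc_to_simplex k x \<in> coord_space k"
  "x \<in> coord_space k \<Longrightarrow> simplex_to_disc k x \<in> coord_space k"
  by (auto simp: coord_space_def disc_to_simplex_def simplex_to_disc_def)

section \<open>The sphere as a Coxeter complex of type A\<close>

definition order_cell :: "nat \<Rightarrow> (nat \<Rightarrow> real) \<Rightarrow> (nat \<Rightarrow> real) set" where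
  "order_cell m y = {z \<in> usphere m. same_order y z}"

text \<open>
  A point with \<open>k + 2\<close> values is determined by \<open>k + 1\<close> gaps between them up to a common factor,
  which leaves \<open>k\<close> degrees of freedom.
\<close>

definition order_cells :: "nat \<Rightarrow> nat \<Rightarrow> (nat \<Rightarrow> real) set set" where
  "order_cells m k = order_cell m ` {y \<in> usphere m. card (range y) = k + 2}"

lemma order_cell_self: "y \<in> usphere m \<Longrightarrow> y \<in> order_cell m y"
  by (simp add: order_cell_def)

lemma order_cell_eq:
  assumes "z \<in> order_cell m y"
  shows "order_cell m z = order_cell m y"
  using assms unfolding order_cell_def
  by (auto intro: same_order_trans same_order_sym)

lemma card_range_usphere:
  assumes "y \<in> usphere m"
  shows "card (range y) \<ge> 2"
proof -
  have y: "y \<in> nonconst m" using assms usphere_subset_nonconst by blast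
  then obtain i where "y i \<noteq> y m" unfolding nonconst_def by blast
  then have "card {y i, y m} = 2" by simp
  moreover have "card {y i, y m} \<le> card (range y)"
    using finite_range_nonconst[OF y] by (intro card_mono) auto
  ultimately show ?thesis by simp
qed

lemma cells_order_cells: "cells (order_cells m) = order_cell m ` usphere m"
proof
  show "order_cell m ` usphere m \<subseteq> cells (order_cells m)"
  proof
    fix e assume "e \<in> order_cell m ` usphere m"
    then obtain y where y: "y \<in> usphere m" "e = order_cell m y" by blast
    then have "e \<in> order_cells m (card (range y) - 2)"
      using card_range_usphere[OF y(1)] by (auto simp: order_cells_def)
    then show "e \<in> cells (order_cells m)" by (auto simp: cells_def)
  qed
qed (auto simp: cells_def order_cells_def)

text \<open>Only the indices up to \<open>m\<close> matter, so an order pattern is one of finitely many relations.\<close>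

lemma finite_order_cells: "finite (cells (order_cells m))"
proof -
  define pat where "pat y = {(i, j) \<in> {..m} \<times> {..m}. y i < y j}" for y :: "nat \<Rightarrow> real"
  have inj: "order_cell m y = order_cell m z"
    if yz: "y \<in> usphere m" "z \<in> usphere m" "pat y = pat z" for y z
  proof -
    have tail: "w i = w (min i m)" if "w \<in> usphere m" for w i
      using that by (auto simp: usphere_def min_def)
    have "y i < y j \<longleftrightarrow> z i < z j" for i j
    proof -
      have "(min i m, min j m) \<in> pat y \<longleftrightarrow> (min i m, min j m) \<in> pat z" using yz(3) by simp
      then have "y (min i m) < y (min j m) \<longleftrightarrow> z (min i m) < z (min j m)" by (simp add: pat_def)
      then show ?thesis using tail yz(1,2) by metis
    qed
    then have "z \<in> order_cell m y" using yz(2) by (simp add: order_cell_def same_order_def)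
    then show ?thesis using order_cell_eq by metis
  qed
  have "finite (pat ` usphere m)"
    by (rule finite_subset[of _ "Pow ({..m} \<times> {..m})"]) (auto simp: pat_def)
  moreover have "order_cell m ` usphere m \<subseteq>
      (\<lambda>P. order_cell m (SOME y. y \<in> usphere m \<and> pat y = P)) ` pat ` usphere m"
  proof
    fix e assume "e \<in> order_cell m ` usphere m"
    then obtain y where y: "y \<in> usphere m" "e = order_cell m y" by blast
    let ?z = "SOME z. z \<in> usphere m \<and> pat z = pat y"
    have "?z \<in> usphere m \<and> pat ?z = pat y" by (rule someI[of _ y]) (simp add: y)
    then have "e = order_cell m ?z" using inj y by metis
    then show "e \<in> (\<lambda>P. order_cell m (SOME y. y \<in> usphere m \<and> pat y = P)) ` pat ` usphere m"
      using y(1) by blast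
  qed
  ultimately show ?thesis unfolding cells_order_cells by (meson finite_imageI finite_subset)
qed

text \<open>
  The map \<open>r\<close> numbers the values of the points of a cell in increasing order, and \<open>rep j\<close> is an index
  at which the value numbered \<open>j\<close> is attained.
\<close>

locale numbered_cell =
  fixes m k :: nat and y0 :: "nat \<Rightarrow> real" and r rep :: "nat \<Rightarrow> nat"
  assumes y0: "y0 \<in> usphere m"
    and range_r: "range r = {..Suc k}"
    and r_less: "\<And>i j. r i < r j \<longleftrightarrow> y0 i < y0 j"
    and r_rep: "\<And>j. j \<le> Suc k \<Longrightarrow> r (rep j) = j"
begin

text \<open>
  The maps between the simplex and the cell. The representative on the sphere is scaled so that the
  extreme levels become \<open>0\<close> and \<open>k + 1\<close>.
\<close>

definition point :: "(nat \<Rightarrow> real) \<Rightarrow> nat \<Rightarrow> real" where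
  "point x = normalize_at m (\<lambda>i. levels x (r i))"

definition coordinates :: "(nat \<Rightarrow> real) \<Rightarrow> nat \<Rightarrow> real" where
  "coordinates y = (\<lambda>j. if j < k
     then real (Suc k) * (y (rep (Suc j)) - y (rep 0)) / (y (rep (Suc k)) - y (rep 0)) - real (Suc j)
     else 0)"

lemma r_le: "r i \<le> Suc k"
  using range_r by (metis atMost_iff rangeI)

lemma r_eq_iff: "r i = r j \<longleftrightarrow> y0 i = y0 j"
  using r_less[of i j] r_less[of j i] by linarith

lemma levels_ends: "levels x 0 = 0" "x \<in> coord_space k \<Longrightarrow> levels x (Suc k) = real (Suc k)"
  by (simp_all add: levels_def coord_space_def)

lemma levels_strict_mono:
  assumes "gauge_upto k x < 1" "i < j" "j \<le> Suc k"
  shows "levels x i < levels x j"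
  using assms(2,3)
proof (induction j)
  case (Suc j)
  have "levels x j < levels x (Suc j)"
    using levels_gap[of x j] assms(1) Suc.prems gauge_less_iff[of k x 1] by force
  then show ?case using Suc by (cases "i = j") auto
qed simp

lemma levels_nonconst:
  assumes "x \<in> coord_space k"
  shows "(\<lambda>i. levels x (r i)) \<in> nonconst m"
proof -
  have tail: "levels x (r i) = levels x (r m)" if "i \<ge> m" for i
  proof -
    have "r i = r m" unfolding r_eq_iff using y0 that by (simp add: usphere_def)
    then show ?thesis by simp
  qed
  have "\<exists>i. levels x (r i) \<noteq> levels x (r m)"
  proof (rule ccontr)
    assume "\<not> ?thesis"
    then have "levels x (r (rep 0)) = levels x (r (rep (Suc k)))" by metis
    then show False using levels_ends assms by (simp add: r_rep)
  qed
  then show ?thesis unfolding nonconst_def using tail by blast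
qed

lemma point_in_usphere: "x \<in> coord_space k \<Longrightarrow> point x \<in> usphere m"
  unfolding point_def by (intro normalize_at_usphere levels_nonconst)

lemma point_in_cell:
  assumes "x \<in> coord_space k" "gauge_upto k x < 1"
  shows "point x \<in> order_cell m y0"
proof -
  have "levels x (r i) < levels x (r j) \<longleftrightarrow> r i < r j" for i j
    using levels_strict_mono[OF assms(2) _ r_le, of "r i" j]
      levels_strict_mono[OF assms(2) _ r_le, of "r j" i]
    by (metis linorder_less_linear order_less_asym)
  then have "same_order y0 (\<lambda>i. levels x (r i))"
    by (simp add: same_order_def r_less)
  then show ?thesis
    using same_order_normalize_at[OF levels_nonconst[OF assms(1)]] point_in_usphere[OF assms(1)]
    unfolding order_cell_def point_def by (auto intro: same_order_trans)
qed

lemma coordinates_point: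
  assumes x: "x \<in> coord_space k"
  shows "coordinates (point x) = x"
proof
  fix j
  obtain a b where a: "a > 0" and ab: "point x = (\<lambda>i. a * levels x (r i) + b)"
    unfolding point_def using normalize_at_affine[OF levels_nonconst[OF x]] .
  have diff: "point x (rep i) - point x (rep 0) = a * levels x i" if "i \<le> Suc k" for i
    using that by (simp add: ab r_rep levels_ends)
  show "coordinates (point x) j = x j"
  proof (cases "j < k")
    case True
    have "coordinates (point x) j
        = real (Suc k) * (a * levels x (Suc j)) / (a * real (Suc k)) - real (Suc j)"
      using True x by (simp only: coordinates_def diff levels_ends if_True Suc_le_mono less_imp_le order_refl)
    also have "\<dots> = levels x (Suc j) - real (Suc j)" using a by (simp del: of_nat_Suc)
    finally show ?thesis by (simp add: levels_def)
  next
    case False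
    then show ?thesis using x by (simp add: coordinates_def coord_space_def)
  qed
qed

lemma rep_increasing:
  assumes "y \<in> order_cell m y0" "i < j" "j \<le> Suc k"
  shows "y (rep i) < y (rep j)"
proof -
  have "r (rep i) < r (rep j)" using assms by (simp add: r_rep)
  then have "y0 (rep i) < y0 (rep j)" by (simp add: r_less)
  then show ?thesis using assms(1) by (simp add: order_cell_def same_order_def)
qed

lemma coordinates_coord_space: "coordinates y \<in> coord_space k"
  by (simp add: coordinates_def coord_space_def)

lemma levels_coordinates:
  assumes y: "y \<in> order_cell m y0" and j: "j \<le> Suc k"
  shows "levels (coordinates y) j
    = real (Suc k) / (y (rep (Suc k)) - y (rep 0)) * (y (rep j) - y (rep 0))"
proof (cases j)
  case 0
  then show ?thesis by (simp add: levels_def)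
next
  case (Suc i)
  have "y (rep 0) < y (rep (Suc k))" using rep_increasing[OF y] by simp
  then show ?thesis
    using Suc j by (cases "i < k") (auto simp: levels_def coordinates_def less_Suc_eq)
qed

lemma gauge_coordinates:
  assumes y: "y \<in> order_cell m y0"
  shows "gauge_upto k (coordinates y) < 1"
  unfolding gauge_less_iff
proof (intro allI impI)
  fix j assume j: "j \<le> k"
  let ?c = "real (Suc k) / (y (rep (Suc k)) - y (rep 0))"
  have c: "?c > 0" using rep_increasing[OF y, of 0 "Suc k"] by simp
  have "levels (coordinates y) (Suc j) - levels (coordinates y) j = ?c * (y (rep (Suc j)) - y (rep j))"
    using j by (simp only: levels_coordinates[OF y] le_SucI Suc_le_mono flip: right_diff_distrib) simp
  also have "\<dots> > 0"
    using j c rep_increasing[OF y, of j "Suc j"] by (intro mult_pos_pos) auto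
  finally show "facet j (coordinates y) < 1" by (simp add: levels_gap)
qed

lemma point_coordinates:
  assumes y: "y \<in> order_cell m y0"
  shows "point (coordinates y) = y"
proof -
  let ?c = "real (Suc k) / (y (rep (Suc k)) - y (rep 0))"
  have c: "?c > 0" using rep_increasing[OF y, of 0 "Suc k"] by simp
  have "y (rep (r i)) = y i" for i
  proof -
    have "r (rep (r i)) = r i" by (simp add: r_rep r_le)
    then have "y0 (rep (r i)) = y0 i" by (simp add: r_eq_iff)
    then show ?thesis using y same_order_eq_iff[of y0 y] by (simp add: order_cell_def)
  qed
  then have "(\<lambda>i. levels (coordinates y) (r i)) = (\<lambda>i. ?c * y i + - ?c * y (rep 0))"
    by (simp only: levels_coordinates[OF y r_le]) (simp add: algebra_simps diff_divide_distrib)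
  then have "point (coordinates y) = normalize_at m (\<lambda>i. ?c * y i + - ?c * y (rep 0))"
    by (simp only: point_def)
  also have "\<dots> = normalize_at m y" by (rule normalize_at_affine_image[OF c])
  finally show ?thesis using y normalize_at_id by (simp add: order_cell_def)
qed

lemma continuous_on_point: "continuous_on (coord_space k) point"
proof -
  have "continuous_on (coord_space k) (\<lambda>x i. levels x (r i))"
  proof (rule continuous_on_coordinatewise_then_product)
    show "continuous_on (coord_space k) (\<lambda>x. levels x (r i))" for i
      unfolding levels_def by (cases "r i") (auto intro!: continuous_intros)
  qed
  moreover have "(\<lambda>x i. levels x (r i)) ` coord_space k \<subseteq> nonconst m" using levels_nonconst by blast
  ultimately show ?thesis
    unfolding point_def by (intro continuous_on_compose2[OF continuous_on_normalize_at])
qed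

lemma continuous_on_coordinates: "continuous_on (order_cell m y0) coordinates"
proof (rule continuous_on_coordinatewise_then_product)
  fix j
  have "y (rep (Suc k)) - y (rep 0) \<noteq> 0" if "y \<in> order_cell m y0" for y
    using rep_increasing[OF that, of 0 "Suc k"] by simp
  then show "continuous_on (order_cell m y0) (\<lambda>y. coordinates y j)"
    unfolding coordinates_def by (cases "j < k") (auto intro!: continuous_intros)
qed

text \<open>On the boundary of the simplex two neighbouring levels coincide, so at least one value is lost.\<close>

lemma point_boundary:
  assumes x: "x \<in> coord_space k" and g: "gauge_upto k x = 1"
  shows "\<exists>d<k. point x \<in> \<Union>(order_cells m d)"
proof -
  have "\<not> gauge_upto k x < 1" "gauge_upto k x \<le> 1" using g by auto
  then obtain j where j: "j \<le> k" "facet j x = 1"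
    unfolding gauge_less_iff gauge_le_iff by (meson less_eq_real_def)
  then have "levels x (Suc j) = levels x j" using levels_gap[of x j] by simp
  then have "\<not> inj_on (levels x) {..Suc k}"
    using inj_onD[of "levels x" "{..Suc k}" "Suc j" j] j(1) by auto
  then have "card (levels x ` {..Suc k}) \<noteq> Suc (Suc k)"
    using eq_card_imp_inj_on[of "{..Suc k}" "levels x"] by auto
  then have lt: "card (levels x ` {..Suc k}) < k + 2"
    using card_image_le[of "{..Suc k}" "levels x"] by simp
  have "range (\<lambda>i. levels x (r i)) = levels x ` {..Suc k}"
    using range_r by (metis image_image)
  then have "card (range (point x)) < k + 2"
    using lt same_order_card_range[OF same_order_normalize_at[OF levels_nonconst[OF x]]]
    by (simp add: point_def)
  moreover have "card (range (point x)) \<ge> 2" "point x \<in> usphere m"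
    using point_in_usphere[OF x] card_range_usphere by auto
  ultimately show ?thesis
    by (intro exI[of _ "card (range (point x)) - 2"]) (auto simp: order_cells_def intro: order_cell_self)
qed

end

lemma Euclidean_space_eq_coord_space: "Euclidean_space k = top_of_set (coord_space k)"
  by (simp add: Euclidean_space_def coord_space_def euclidean_product_topology)

lemma disc_eq:
  "closed_disc k = {x \<in> coord_space k. L2_set x {..<k} \<le> 1}"
  "open_disc k = {x \<in> coord_space k. L2_set x {..<k} < 1}"
  by (auto simp: closed_disc_def open_disc_def topspace_Euclidean_space coord_space_def L2_set_def)

text \<open>
  The characteristic map takes a disc radially to the simplex of increasing level sequences and
  distributes the levels over the indices according to the order pattern of the cell.
\<close>

lemma characteristic_map_order_cell:
  assumes e: "e \<in> order_cells (Suc p) k"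
  shows "\<exists>f. characteristic_map (nsphere p) (order_cells (Suc p)) k e f"
proof -
  define m where "m = Suc p"
  obtain y0 where pattern: "y0 \<in> usphere m" "card (range y0) = k + 2" "e = order_cell m y0"
    using e by (auto simp: order_cells_def m_def)
  have fin: "finite (range y0)" using pattern(1) usphere_subset_nonconst finite_range_nonconst by blast
  obtain r where r: "range r = {..<card (range y0)}" "\<And>i j. r i < r j \<longleftrightarrow> y0 i < y0 j"
    using rank_exists[OF fin] by metis
  have range_r: "range r = {..Suc k}" using r(1) pattern(2) by (auto simp: less_Suc_eq_le)
  then have "\<forall>j\<le>Suc k. \<exists>i. r i = j" by (metis atMost_iff imageE)
  then obtain rep where rep: "\<And>j. j \<le> Suc k \<Longrightarrow> r (rep j) = j" by metis
  interpret numbered_cell m k y0 r rep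
    by unfold_locales (use pattern(1) range_r r(2) rep in auto)
  define f where "f = (\<lambda>x. point (disc_to_simplex k x))"
  define g where "g = (\<lambda>y. simplex_to_disc k (coordinates y))"
  have f_cont: "continuous_on (coord_space k) f"
    unfolding f_def
    by (rule continuous_on_compose2[OF continuous_on_point continuous_on_disc_to_simplex])
       (auto intro: radial_coord_space)
  have g_cont: "continuous_on e g"
    unfolding g_def pattern(3)
    by (rule continuous_on_compose2[OF continuous_on_simplex_to_disc continuous_on_coordinates])
       (auto intro: coordinates_coord_space)
  have f_e: "f x \<in> e" if "x \<in> open_disc k" for x
    unfolding f_def pattern(3) using that
    by (intro point_in_cell) (auto simp: disc_eq radial_coord_space gauge_disc_to_simplex)
  have g_disc: "g y \<in> open_disc k" if "y \<in> e" for y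
    unfolding g_def using that gauge_coordinates
    by (simp add: disc_eq pattern(3) radial_coord_space L2_simplex_to_disc coordinates_coord_space)
  have gf: "g (f x) = x" if "x \<in> open_disc k" for x
    using that
    by (simp add: disc_eq f_def g_def coordinates_point radial_coord_space simplex_to_disc_inverse)
  have fg: "f (g y) = y" if "y \<in> e" for y
    using that
    by (simp add: f_def g_def pattern(3) point_coordinates coordinates_coord_space disc_to_simplex_inverse)
  have sub: "closed_disc k \<subseteq> coord_space k" "open_disc k \<subseteq> coord_space k" "e \<subseteq> usphere m"
    by (auto simp: disc_eq pattern(3) order_cell_def)
  have tops: "subtopology (Euclidean_space k) (closed_disc k) = top_of_set (closed_disc k)"
    "subtopology (Euclidean_space k) (open_disc k) = top_of_set (open_disc k)"
    "subtopology (nsphere p) e = top_of_set e"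
    using sub unfolding Euclidean_space_eq_coord_space nsphere_eq_usphere subtopology_subtopology m_def
    by (simp_all add: Int_absorb1)
  have "continuous_map (top_of_set (closed_disc k)) (nsphere p) f"
    unfolding nsphere_eq_usphere m_def[symmetric]
    using continuous_on_subset[OF f_cont sub(1)] sub(1)
    by (auto simp: f_def intro: point_in_usphere radial_coord_space)
  moreover have "homeomorphic_maps (top_of_set (open_disc k)) (top_of_set e) f g"
    using continuous_on_subset[OF f_cont sub(2)] g_cont f_e g_disc gf fg
    by (auto simp: homeomorphic_maps_def)
  moreover have "\<exists>F. finite F \<and> F \<subseteq> (\<Union>d<k. order_cells m d) \<and> f ` (closed_disc k - open_disc k) \<subseteq> \<Union>F"
  proof (intro exI conjI)
    show "finite (\<Union>d<k. order_cells m d)"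
      by (rule finite_subset[OF _ finite_order_cells[of m]]) (auto simp: cells_def)
    show "f ` (closed_disc k - open_disc k) \<subseteq> \<Union>(\<Union>d<k. order_cells m d)"
    proof
      fix z assume "z \<in> f ` (closed_disc k - open_disc k)"
      then obtain x where x: "x \<in> closed_disc k - open_disc k" "z = f x" by blast
      then have "x \<in> coord_space k" "L2_set x {..<k} = 1" by (auto simp: disc_eq)
      then show "z \<in> \<Union>(\<Union>d<k. order_cells m d)"
        using x(2) point_boundary[of "disc_to_simplex k x"]
        by (auto simp: f_def radial_coord_space gauge_disc_to_simplex)
    qed
  qed simp
  ultimately show ?thesis
    unfolding characteristic_map_def tops m_def using homeomorphic_maps_imp_map by blast
qed

lemma cw_complex_order_cells: "cw_complex (nsphere p) (order_cells (Suc p))"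
proof -
  define m where "m = Suc p"
  have top: "topspace (nsphere p) = usphere m" by (simp add: nsphere_eq_usphere m_def)
  have Hausdorff: "Hausdorff_space (nsphere p)"
    unfolding nsphere
    by (intro Hausdorff_space_subtopology) (simp add: Hausdorff_space_product_topology)
  have cover: "\<Union>(cells (order_cells m)) = usphere m"
    unfolding cells_order_cells by (auto simp: order_cell_def)
  have disjoint: "d \<inter> e = {}"
    if de: "d \<in> order_cells m i" "e \<in> order_cells m j" "(i, d) \<noteq> (j, e)" for i j d e
  proof (rule ccontr)
    assume "d \<inter> e \<noteq> {}"
    then obtain x where x: "x \<in> d" "x \<in> e" by blast
    have cell: "order_cell m x = c \<and> card (range x) = l + 2" if c: "c \<in> order_cells m l" "x \<in> c" for c l
    proof -
      obtain y where y: "y \<in> usphere m" "card (range y) = l + 2" "c = order_cell m y"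
        using c(1) by (auto simp: order_cells_def)
      then show ?thesis
        using c(2) order_cell_eq same_order_card_range[of y x] by (auto simp: order_cell_def)
    qed
    show False using cell[OF de(1) x(1)] cell[OF de(2) x(2)] de(3) by simp
  qed
  have weak: "closedin (nsphere p) A"
    if A: "A \<subseteq> usphere m" "\<forall>e\<in>cells (order_cells m). closedin (nsphere p) (A \<inter> nsphere p closure_of e)" for A
  proof -
    have sub: "e \<subseteq> nsphere p closure_of e" if "e \<in> cells (order_cells m)" for e
      using that cover by (intro closure_of_subset) (auto simp: top)
    have "A \<subseteq> (\<Union>e\<in>cells (order_cells m). A \<inter> nsphere p closure_of e)"
    proof
      fix x assume x: "x \<in> A"
      then obtain e where "e \<in> cells (order_cells m)" "x \<in> e" using A(1) cover by blast
      then show "x \<in> (\<Union>e\<in>cells (order_cells m). A \<inter> nsphere p closure_of e)"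
        using x sub[of e] by blast
    qed
    then have "A = (\<Union>e\<in>cells (order_cells m). A \<inter> nsphere p closure_of e)" by auto
    moreover have "closedin (nsphere p) (\<Union>e\<in>cells (order_cells m). A \<inter> nsphere p closure_of e)"
      using A(2) finite_order_cells by (intro closedin_Union) auto
    ultimately show ?thesis by simp
  qed
  have char: "\<exists>f. characteristic_map (nsphere p) (order_cells m) k e f" if "e \<in> order_cells m k" for k e
    using that unfolding m_def by (rule characteristic_map_order_cell)
  show ?thesis
    unfolding cw_complex_def top m_def[symmetric]
  proof (intro conjI)
    show "\<forall>i j d e. d \<in> order_cells m i \<and> e \<in> order_cells m j \<and> (i, d) \<noteq> (j, e) \<longrightarrow> d \<inter> e = {}"
      by (intro allI impI, elim conjE, rule disjoint)
    show "\<forall>A\<subseteq>usphere m. (\<forall>e\<in>cells (order_cells m). closedin (nsphere p) (A \<inter> nsphere p closure_of e))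
        \<longrightarrow> closedin (nsphere p) A"
      by (intro allI impI, rule weak)
    show "\<forall>k. \<forall>e\<in>order_cells m k. \<exists>f. characteristic_map (nsphere p) (order_cells m) k e f"
      by (intro allI ballI, rule char)
  qed (rule Hausdorff, rule cover)
qed

section \<open>Actions preserving order patterns\<close>

text \<open>
  An action on sequences that is compatible with positive factors and additive constants descends
  to the sphere. The cells are permuted because order patterns are, and \<open>rigid\<close> is the requirement
  that stabilizers of cells fix them pointwise.
\<close>

locale order_action = group G for G :: "'g monoid" (structure) +
  fixes p :: nat and \<psi> :: "'g \<Rightarrow> (nat \<Rightarrow> real) \<Rightarrow> nat \<Rightarrow> real"
  assumes nonconst: "\<And>g z. g \<in> carrier G \<Longrightarrow> z \<in> nonconst (Suc p) \<Longrightarrow> \<psi> g z \<in> nonconst (Suc p)"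
    and affine: "\<And>g a z b. g \<in> carrier G \<Longrightarrow> a > 0 \<Longrightarrow> \<exists>b'. \<psi> g (\<lambda>i. a * z i + b) = (\<lambda>i. a * \<psi> g z i + b')"
    and mult: "\<And>g h z. g \<in> carrier G \<Longrightarrow> h \<in> carrier G \<Longrightarrow> z \<in> nonconst (Suc p) \<Longrightarrow> \<psi> (g \<otimes> h) z = \<psi> g (\<psi> h z)"
    and one: "\<And>z. z \<in> nonconst (Suc p) \<Longrightarrow> \<psi> \<one> z = z"
    and order: "\<And>g y z. g \<in> carrier G \<Longrightarrow> same_order y z \<Longrightarrow> same_order (\<psi> g y) (\<psi> g z)"
    and rigid: "\<And>g z. g \<in> carrier G \<Longrightarrow> z \<in> nonconst (Suc p) \<Longrightarrow> same_order (\<psi> g z) z \<Longrightarrow> \<psi> g z = z"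
    and continuous: "\<And>g. g \<in> carrier G \<Longrightarrow> continuous_on UNIV (\<psi> g)"
begin

abbreviation "m \<equiv> Suc p"

definition sphere_act :: "'g \<Rightarrow> (nat \<Rightarrow> real) \<Rightarrow> nat \<Rightarrow> real" where
  "sphere_act g = restrict (\<lambda>y. normalize_at m (\<psi> g y)) (usphere m)"

lemma sphere_act_in:
  assumes "g \<in> carrier G" "y \<in> usphere m"
  shows "sphere_act g y \<in> usphere m"
  using assms usphere_subset_nonconst
  by (auto simp: sphere_act_def intro!: normalize_at_usphere nonconst)

lemma sphere_act_one: "y \<in> usphere m \<Longrightarrow> sphere_act \<one> y = y"
  using subsetD[OF usphere_subset_nonconst] by (simp add: sphere_act_def one normalize_at_id)

lemma sphere_act_mult:
  assumes g: "g \<in> carrier G" and h: "h \<in> carrier G" and y: "y \<in> usphere m"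
  shows "sphere_act (g \<otimes> h) y = sphere_act g (sphere_act h y)"
proof -
  have y': "y \<in> nonconst m" using y usphere_subset_nonconst by blast
  obtain a b where a: "a > 0" and ab: "normalize_at m (\<psi> h y) = (\<lambda>i. a * \<psi> h y i + b)"
    using normalize_at_affine[OF nonconst[OF h y']] .
  obtain b' where b': "\<psi> g (\<lambda>i. a * \<psi> h y i + b) = (\<lambda>i. a * \<psi> g (\<psi> h y) i + b')"
    using affine[OF g a] by blast
  have "sphere_act h y = normalize_at m (\<psi> h y)" using y by (simp add: sphere_act_def)
  then have "sphere_act g (sphere_act h y) = normalize_at m (\<psi> g (normalize_at m (\<psi> h y)))"
    using sphere_act_in[OF h y] by (simp add: sphere_act_def)
  also have "\<dots> = normalize_at m (\<psi> g (\<psi> h y))"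
    unfolding ab b' by (rule normalize_at_affine_image[OF a])
  also have "\<dots> = sphere_act (g \<otimes> h) y"
    using y by (simp add: sphere_act_def mult[OF g h y'])
  finally show ?thesis by simp
qed

lemma sphere_act_inv:
  assumes "g \<in> carrier G" "y \<in> usphere m"
  shows "sphere_act (inv g) (sphere_act g y) = y" "sphere_act g (sphere_act (inv g) y) = y"
  using assms sphere_act_mult[of "inv g" g y] sphere_act_mult[of g "inv g" y] sphere_act_one[of y]
  by simp_all

lemma sphere_act_order:
  assumes g: "g \<in> carrier G" and y: "y \<in> usphere m"
  shows "same_order (\<psi> g y) (sphere_act g y)"
  using y usphere_subset_nonconst same_order_normalize_at[OF nonconst[OF g]]
  by (auto simp: sphere_act_def)

lemma sphere_act_fixed_iff:
  assumes g: "g \<in> carrier G" and y: "y \<in> usphere m"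
  shows "sphere_act g y = y \<longleftrightarrow> \<psi> g y = y"
proof
  assume "sphere_act g y = y"
  then have "same_order (\<psi> g y) y" using sphere_act_order[OF g y] by simp
  then show "\<psi> g y = y" using rigid[OF g] y usphere_subset_nonconst by blast
qed (use y in \<open>simp add: sphere_act_def normalize_at_id\<close>)

lemma sphere_act_cell_subset:
  assumes g: "g \<in> carrier G" and y: "y \<in> usphere m"
  shows "sphere_act g ` order_cell m y \<subseteq> order_cell m (sphere_act g y)"
proof
  fix w assume "w \<in> sphere_act g ` order_cell m y"
  then obtain z where z: "z \<in> usphere m" "same_order y z" "w = sphere_act g z"
    by (auto simp: order_cell_def)
  have "same_order (sphere_act g y) (\<psi> g z)"
    using same_order_sym[OF sphere_act_order[OF g y]] order[OF g z(2)] by (rule same_order_trans)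
  then have "same_order (sphere_act g y) w"
    unfolding z(3) using sphere_act_order[OF g z(1)] by (rule same_order_trans)
  then show "w \<in> order_cell m (sphere_act g y)"
    using sphere_act_in[OF g z(1)] z(3) by (simp add: order_cell_def)
qed

lemma sphere_act_cell:
  assumes g: "g \<in> carrier G" and y: "y \<in> usphere m"
  shows "sphere_act g ` order_cell m y = order_cell m (sphere_act g y)"
proof
  show "order_cell m (sphere_act g y) \<subseteq> sphere_act g ` order_cell m y"
  proof
    fix w assume w: "w \<in> order_cell m (sphere_act g y)"
    then have "sphere_act (inv g) w \<in> order_cell m (sphere_act (inv g) (sphere_act g y))"
      using sphere_act_cell_subset[OF inv_closed[OF g] sphere_act_in[OF g y]] by blast
    then have "sphere_act (inv g) w \<in> order_cell m y" by (simp add: sphere_act_inv g y)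
    moreover have "w = sphere_act g (sphere_act (inv g) w)"
      using w g by (simp add: sphere_act_inv order_cell_def)
    ultimately show "w \<in> sphere_act g ` order_cell m y" by blast
  qed
qed (rule sphere_act_cell_subset[OF g y])

lemma group_action_sphere_act: "group_action G (usphere m) sphere_act"
proof -
  have Bij: "sphere_act g \<in> Bij (usphere m)" if g: "g \<in> carrier G" for g
  proof -
    have "bij_betw (sphere_act g) (usphere m) (usphere m)"
      using g by (intro bij_betw_byWitness[where f' = "sphere_act (inv g)"])
        (auto simp: sphere_act_inv sphere_act_in)
    then show ?thesis by (simp add: Bij_def sphere_act_def)
  qed
  have "sphere_act (g \<otimes> h) = compose (usphere m) (sphere_act g) (sphere_act h)"
    if "g \<in> carrier G" "h \<in> carrier G" for g h
  proof
    show "sphere_act (g \<otimes> h) y = compose (usphere m) (sphere_act g) (sphere_act h) y" for y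
    proof (cases "y \<in> usphere m")
      case True
      then show ?thesis using that by (simp add: sphere_act_mult compose_eq)
    next
      case False
      then show ?thesis by (simp add: compose_def sphere_act_def)
    qed
  qed
  then have "sphere_act \<in> hom G (BijGroup (usphere m))"
    using Bij by (auto simp: hom_def BijGroup_def)
  then show ?thesis
    unfolding group_action_def group_hom_def group_hom_axioms_def
    using group_BijGroup is_group by blast
qed

lemma continuous_on_sphere_act:
  assumes g: "g \<in> carrier G"
  shows "continuous_on (usphere m) (sphere_act g)"
proof -
  have "continuous_on (usphere m) (\<lambda>y. normalize_at m (\<psi> g y))"
  proof (rule continuous_on_compose2[OF continuous_on_normalize_at])
    show "continuous_on (usphere m) (\<psi> g)"
      using continuous[OF g] continuous_on_subset by blast
    show "\<psi> g ` usphere m \<subseteq> nonconst m"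
      using nonconst[OF g] usphere_subset_nonconst by blast
  qed
  then show ?thesis by (rule continuous_on_eq) (simp add: sphere_act_def)
qed

lemma cellular_action_sphere_act:
  "cellular_action G (nsphere p) (order_cells m) sphere_act"
  unfolding cellular_action_def
proof (intro conjI ballI impI)
  show "group_action G (topspace (nsphere p)) sphere_act"
    using group_action_sphere_act by (simp add: nsphere_eq_usphere)
next
  fix g assume g: "g \<in> carrier G"
  have "homeomorphic_maps (nsphere p) (nsphere p) (sphere_act g) (sphere_act (inv g))"
    unfolding homeomorphic_maps_def nsphere_eq_usphere
    using g by (auto simp: sphere_act_inv sphere_act_in continuous_on_sphere_act)
  then show "homeomorphic_map (nsphere p) (nsphere p) (sphere_act g)"
    by (rule homeomorphic_maps_imp_map)
  have inv_image: "sphere_act (inv h) ` sphere_act h ` e = e"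
    if h: "h \<in> carrier G" and e: "e \<in> cells (order_cells m)" for h e
  proof -
    obtain y where "y \<in> usphere m" "e = order_cell m y"
      using e by (auto simp: cells_order_cells)
    then show ?thesis
      using h by (simp add: sphere_act_cell sphere_act_in sphere_act_inv)
  qed
  have into: "sphere_act h ` e \<in> cells (order_cells m)"
    if "h \<in> carrier G" "e \<in> cells (order_cells m)" for h e
    using that by (auto simp: cells_order_cells sphere_act_cell sphere_act_in)
  show "bij_betw (\<lambda>e. sphere_act g ` e) (cells (order_cells m)) (cells (order_cells m))"
  proof (rule bij_betw_byWitness[where f' = "\<lambda>e. sphere_act (inv g) ` e"])
    show "\<forall>e\<in>cells (order_cells m). sphere_act (inv g) ` sphere_act g ` e = e"
      using inv_image[OF g] by blast
    show "\<forall>e\<in>cells (order_cells m). sphere_act g ` sphere_act (inv g) ` e = e"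
      using inv_image[OF inv_closed[OF g]] g by simp
    show "(\<lambda>e. sphere_act g ` e) ` cells (order_cells m) \<subseteq> cells (order_cells m)"
      using into[OF g] by blast
    show "(\<lambda>e. sphere_act (inv g) ` e) ` cells (order_cells m) \<subseteq> cells (order_cells m)"
      using into[OF inv_closed[OF g]] by blast
  qed
next
  fix e g x
  assume e: "e \<in> cells (order_cells m)" and g: "g \<in> carrier G" and fix_e: "sphere_act g ` e = e"
    and x: "x \<in> e"
  obtain y where y: "e = order_cell m y" using e by (auto simp: cells_order_cells)
  have xS: "x \<in> usphere m" using x y by (simp add: order_cell_def)
  have "sphere_act g x \<in> e" using fix_e x by blast
  then have "same_order (sphere_act g x) x"
    using x unfolding y order_cell_def by (auto intro: same_order_trans same_order_sym)
  then have "same_order (\<psi> g x) x"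
    using sphere_act_order[OF g xS] by (rule same_order_trans[rotated])
  then have "\<psi> g x = x" using rigid[OF g] xS usphere_subset_nonconst by blast
  then show "sphere_act g x = x" using sphere_act_fixed_iff[OF g xS] by simp
qed

end

section \<open>Actions of finite groups without global fixed points\<close>

text \<open>
  Left translation permutes the elements of the group. Numbering them by \<open>0, \<dots>, m\<close> gives an action on
  sequences of \<open>m + 1\<close> numbers; it is transitive on indices, so that only constants are fixed.
\<close>

lemma regular_order_action:
  fixes G :: "'g monoid" (structure)
  assumes G: "group G" and card: "card (carrier G) = Suc (Suc p)"
  obtains \<psi> where "order_action G p \<psi>"
    "\<And>z. z \<in> nonconst (Suc p) \<Longrightarrow> \<exists>g\<in>carrier G. \<psi> g z \<noteq> z"
proof -
  interpret group G by fact
  define m where "m = Suc p"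
  have fin: "finite (carrier G)" using card by (simp add: card_ge_0_finite)
  have "card {..m} = card (carrier G)" using card by (simp add: m_def)
  then obtain \<beta> where \<beta>: "bij_betw \<beta> {..m} (carrier G)"
    using finite_same_card_bij[OF _ fin] by blast
  define \<gamma> where "\<gamma> = inv_into {..m} \<beta>"
  have \<beta>_in: "\<beta> (min i m) \<in> carrier G" for i
    using \<beta> by (auto simp: bij_betw_def)
  have \<gamma>_le: "\<gamma> x \<le> m" and \<beta>_\<gamma>: "\<beta> (\<gamma> x) = x" if "x \<in> carrier G" for x
    using that \<beta> bij_betw_inv_into_right[OF \<beta>] inv_into_into[of x \<beta> "{..m}"]
    by (auto simp: \<gamma>_def bij_betw_def)
  have \<gamma>_\<beta>: "\<gamma> (\<beta> i) = i" if "i \<le> m" for i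
    using that bij_betw_inv_into_left[OF \<beta>] by (simp add: \<gamma>_def)
  \<comment> \<open>Capping the index at \<open>m\<close> makes the translated sequences constant from \<open>m\<close> on.\<close>
  define t where "t g i = \<gamma> (inv g \<otimes> \<beta> (min i m))" for g i
  have t_le: "t g i \<le> m" if "g \<in> carrier G" for g i
    using that \<beta>_in by (simp add: t_def \<gamma>_le)
  have t_mult: "t h (t g i) = t (g \<otimes> h) i" if "g \<in> carrier G" "h \<in> carrier G" for g h i
  proof -
    have "\<beta> (min (t g i) m) = inv g \<otimes> \<beta> (min i m)"
      using that t_le[of g i] \<beta>_in by (simp add: min_absorb1 t_def \<beta>_\<gamma>)
    then show ?thesis
      using that \<beta>_in by (simp add: t_def[of h] t_def[of "g \<otimes> h"] inv_mult_group m_assoc)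
  qed
  have t_one: "t \<one> i = min i m" for i
    using \<beta>_in by (simp add: t_def \<gamma>_\<beta>)
  have t_trans: "\<exists>g\<in>carrier G. t g i = m" if "i \<le> m" for i
  proof
    have c: "\<beta> i \<in> carrier G" "\<beta> m \<in> carrier G" using \<beta>_in[of i] \<beta>_in[of m] that by auto
    have "inv (\<beta> i \<otimes> inv \<beta> m) \<otimes> \<beta> i = \<beta> m"
      using c by (simp add: inv_mult_group m_assoc)
    then show "t (\<beta> i \<otimes> inv \<beta> m) i = m"
      using that by (simp add: t_def min_absorb1 \<gamma>_\<beta>)
    show "\<beta> i \<otimes> inv \<beta> m \<in> carrier G" using c by simp
  qed
  have comp_one: "z \<circ> t \<one> = z" if "z \<in> nonconst m" for z
  proof
    show "(z \<circ> t \<one>) i = z i" for i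
      using nonconst_tail[OF that, of i] by (cases "i \<le> m") (auto simp: t_one min_def)
  qed
  have comp_mult: "z \<circ> t (g \<otimes> h) = (z \<circ> t h) \<circ> t g" if "g \<in> carrier G" "h \<in> carrier G" for z :: "nat \<Rightarrow> real" and g h
    using that by (auto simp: t_mult)
  have "order_action G p (\<lambda>g z. z \<circ> t g)"
    unfolding order_action_def order_action_axioms_def m_def[symmetric]
  proof (intro conjI allI impI)
    show "group G" by fact
    fix g assume g: "g \<in> carrier G"
    fix z assume z: "z \<in> nonconst m"
    show "z \<circ> t g \<in> nonconst m"
    proof -
      have "\<exists>i. (z \<circ> t g) i \<noteq> (z \<circ> t g) m"
      proof (rule ccontr)
        assume "\<not> ?thesis"
        then have const: "z (t g i) = z (t g m)" for i by auto
        have "z i = z (t g m)" for i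
        proof -
          have "z i = ((z \<circ> t g) \<circ> t (inv g)) i"
            using comp_mult[of "inv g" g z] comp_one[OF z] g by simp
          then show ?thesis using const by simp
        qed
        then have "z i = z m" for i by metis
        then show False using z unfolding nonconst_def by blast
      qed
      moreover have "(z \<circ> t g) i = (z \<circ> t g) m" if "i \<ge> m" for i
        using that by (simp add: t_def min_def)
      ultimately show ?thesis unfolding nonconst_def by blast
    qed
    show "z \<circ> t g = z" if "same_order (z \<circ> t g) z"
      using same_order_comp_imp_eq[OF finite_range_nonconst[OF z] that] .
  next
    fix g h and z :: "nat \<Rightarrow> real"
    assume "g \<in> carrier G" "h \<in> carrier G"
    then show "z \<circ> t (g \<otimes> h) = z \<circ> t h \<circ> t g" by (rule comp_mult)
  next
    fix z assume "z \<in> nonconst m"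
    then show "z \<circ> t \<one> = z" by (rule comp_one)
  next
    fix g show "continuous_on UNIV (\<lambda>z :: nat \<Rightarrow> real. z \<circ> t g)"
      by (rule continuous_on_coordinatewise_then_product) (simp add: continuous_on_coordinate)
  qed (auto simp: same_order_def fun_eq_iff)
  moreover have "\<exists>g\<in>carrier G. z \<circ> t g \<noteq> z" if z: "z \<in> nonconst m" for z
  proof (rule ccontr)
    assume "\<not> ?thesis"
    then have inv: "z \<circ> t g = z" if "g \<in> carrier G" for g using that by blast
    have "z i = z m" for i
    proof (cases "i \<le> m")
      case True
      then obtain g where "g \<in> carrier G" "t g i = m" using t_trans by blast
      then show ?thesis using inv[of g] by (metis comp_apply)
    next
      case False
      then show ?thesis using nonconst_tail[OF z, of i] by simp
    qed
    then show False using z unfolding nonconst_def by blast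
  qed
  ultimately show thesis using that unfolding m_def by blast
qed

text \<open>
  The regular action of a group of order two lives on \<open>S\<^sup>0\<close>, but the antipode of any sphere reverses
  all order patterns and hence fixes no cell.
\<close>

lemma antipodal_order_action:
  fixes G :: "'g monoid" (structure)
  assumes G: "group G" and card: "card (carrier G) = 2"
  obtains \<psi> where "order_action G p \<psi>"
    "\<And>z. z \<in> nonconst (Suc p) \<Longrightarrow> \<exists>g\<in>carrier G. \<psi> g z \<noteq> z"
proof -
  interpret group G by fact
  obtain a b where ab: "carrier G = {a, b}" "a \<noteq> b" using card by (auto simp: card_2_iff)
  have "\<one> = a \<or> \<one> = b" using one_closed ab(1) by blast
  then obtain s where carrier: "carrier G = {\<one>, s}" and "s \<noteq> \<one>"
    using ab by (metis insert_commute)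
  then have s: "s \<in> carrier G" "s \<noteq> \<one>" by auto
  have ss: "s \<otimes> s = \<one>"
  proof -
    have "s \<otimes> s \<noteq> s" using s l_cancel_one[OF s(1) s(1)] by simp
    then show ?thesis using carrier m_closed[OF s(1) s(1)] by blast
  qed
  define \<psi> :: "'g \<Rightarrow> (nat \<Rightarrow> real) \<Rightarrow> nat \<Rightarrow> real"
    where "\<psi> g z = (if g = \<one> then z else (\<lambda>i. - z i))" for g z
  have neg: "\<not> same_order (\<lambda>i. - z i) z" if z: "z \<in> nonconst n" for z n
  proof
    assume "same_order (\<lambda>i. - z i) z"
    then have swap: "z j < z i \<longleftrightarrow> z i < z j" for i j by (simp add: same_order_def)
    have "z i = z n" for i using swap[of n i] by linarith
    then show False using z unfolding nonconst_def by blast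
  qed
  have "order_action G p \<psi>"
    unfolding order_action_def order_action_axioms_def
  proof (intro conjI allI impI)
    show "group G" by fact
    fix g assume g: "g \<in> carrier G"
    show "\<psi> g z \<in> nonconst (Suc p)" if "z \<in> nonconst (Suc p)" for z
    proof -
      have "(\<lambda>i. - z i) \<in> nonconst (Suc p)"
        using that unfolding nonconst_def mem_Collect_eq neg_equal_iff_equal .
      then show ?thesis using that by (simp add: \<psi>_def)
    qed
    show "\<psi> g z = z" if "z \<in> nonconst (Suc p)" "same_order (\<psi> g z) z" for z
      using that neg[of z "Suc p"] by (cases "g = \<one>") (simp_all add: \<psi>_def)
    show "\<exists>b'. \<psi> g (\<lambda>i. a * z i + b) = (\<lambda>i. a * \<psi> g z i + b')" for a b z
    proof (cases "g = \<one>")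
      case True
      then show ?thesis by (auto simp: \<psi>_def)
    next
      case False
      then show ?thesis by (intro exI[of _ "- b"]) (simp add: \<psi>_def)
    qed
    show "same_order (\<psi> g y) (\<psi> g z)" if "same_order y z" for y z
      using that by (simp add: \<psi>_def same_order_def)
    show "continuous_on UNIV (\<psi> g)"
      unfolding \<psi>_def by (cases "g = \<one>") (auto intro!: continuous_intros)
    show "\<psi> (g \<otimes> h) z = \<psi> g (\<psi> h z)" if "h \<in> carrier G" for h z
      using g that s(2) unfolding carrier by (auto simp: \<psi>_def ss s(1))
  qed (simp add: \<psi>_def)
  moreover have "\<psi> s z \<noteq> z" if "z \<in> nonconst (Suc p)" for z
  proof
    assume "\<psi> s z = z"
    then have "(\<lambda>i. - z i) = z" using s(2) by (simp add: \<psi>_def)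
    then show False using neg[OF that] same_order_refl[of z] by metis
  qed
  ultimately show thesis using that s(1) by blast
qed

lemma exists_fixed_point_free_cellular_action:
  fixes G :: "'g monoid"
  assumes G: "group G" and fin: "finite (carrier G)" and card: "card (carrier G) \<ge> 2"
  shows "\<exists>X E \<phi>. (X, E) \<in> P3 \<and> cellular_action G X E \<phi> \<and>
    (\<forall>x\<in>topspace X. \<exists>g\<in>carrier G. \<phi> g x \<noteq> x)"
proof -
  obtain p \<psi> where p: "p > 0" and act: "order_action G p \<psi>"
    and free: "\<And>z. z \<in> nonconst (Suc p) \<Longrightarrow> \<exists>g\<in>carrier G. \<psi> g z \<noteq> z"
  proof (cases "card (carrier G) = 2")
    case True
    then show thesis using antipodal_order_action[OF G True, of 1] that[of 1] by auto
  next
    case False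
    define p where "p = card (carrier G) - 2"
    have "p > 0" "card (carrier G) = Suc (Suc p)" using card False by (auto simp: p_def)
    then show thesis using regular_order_action[OF G, of p] that[of p] by metis
  qed
  interpret order_action G p \<psi> by fact
  have "(nsphere p, order_cells (Suc p)) \<in> P3"
    using cw_complex_order_cells p by (auto simp: P3_def)
  moreover have "\<forall>x\<in>topspace (nsphere p). \<exists>g\<in>carrier G. sphere_act g x \<noteq> x"
  proof
    fix x assume "x \<in> topspace (nsphere p)"
    then have x: "x \<in> usphere (Suc p)" by (simp add: nsphere_eq_usphere)
    then show "\<exists>g\<in>carrier G. sphere_act g x \<noteq> x"
      using free usphere_subset_nonconst sphere_act_fixed_iff[OF _ x] by blast
  qed
  ultimately show ?thesis using cellular_action_sphere_act by blast
qed

section \<open>The class generated by spheres\<close>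

text \<open>Without a global fixed point every isotropy group is a proper subgroup, hence of smaller order.\<close>

lemma finite_group_in_Ncell:
  fixes G :: "'g monoid"
  assumes "group G" "finite (carrier G)"
  shows "G \<in> Ncell P3"
  using assms
proof (induction "card (carrier G)" arbitrary: G rule: less_induct)
  case less
  interpret group G by fact
  show ?case
  proof (cases "card (carrier G) \<ge> 2")
    case False
    have "carrier G \<subseteq> {\<one>\<^bsub>G\<^esub>}"
    proof
      fix x assume "x \<in> carrier G"
      then have "card {x, \<one>\<^bsub>G\<^esub>} \<le> card (carrier G)" using less.prems(2) by (intro card_mono) auto
      then show "x \<in> {\<one>\<^bsub>G\<^esub>}" using False by (cases "x = \<one>\<^bsub>G\<^esub>") auto
    qed
    then show ?thesis by (intro Ncell.trivial) (simp add: trivial_group_subset)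
  next
    case True
    then obtain X E \<phi> where XE: "(X, E) \<in> P3" and act: "cellular_action G X E \<phi>"
      and free: "\<forall>x\<in>topspace X. \<exists>g\<in>carrier G. \<phi> g x \<noteq> x"
      using exists_fixed_point_free_cellular_action[OF less.prems] by metis
    have ga: "group_action G (topspace X) \<phi>" using act by (simp add: cellular_action_def)
    have "G\<lparr>carrier := stabilizer G \<phi> x\<rparr> \<in> Ncell P3" if x: "x \<in> topspace X" for x
    proof (rule less.hyps)
      have sub: "stabilizer G \<phi> x \<subset> carrier G"
        using free x by (auto simp: stabilizer_def)
      then show "card (carrier (G\<lparr>carrier := stabilizer G \<phi> x\<rparr>)) < card (carrier G)"
        using less.prems(2) by (simp add: psubset_card_mono)
      show "group (G\<lparr>carrier := stabilizer G \<phi> x\<rparr>)"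
        using group_action.stabilizer_subgroup[OF ga x] by (rule subgroup_imp_group)
      show "finite (carrier (G\<lparr>carrier := stabilizer G \<phi> x\<rparr>))"
        using sub less.prems(2) finite_subset by auto
    qed
    then show ?thesis using Ncell.action[OF less.prems(1) XE act] by blast
  qed
qed

text \<open>
  A compact complex has finitely many cells, and an element moving a cell to itself fixes its points.
  Hence the group is a finite union of cosets of an isotropy group.
\<close>

lemma finite_if_cellular_action:
  fixes G :: "'g monoid" (structure)
  assumes "cellular_action G X E \<phi>" and cw: "cw_complex X E" and fin: "finite (cells E)"
    and x: "x \<in> topspace X" and stab: "finite (stabilizer G \<phi> x)"
  shows "finite (carrier G)"
proof -
  have ga: "group_action G (topspace X) \<phi>"
    and bij: "\<And>g. g \<in> carrier G \<Longrightarrow> bij_betw (\<lambda>e. \<phi> g ` e) (cells E) (cells E)"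
    and ptw: "\<And>e g x. e \<in> cells E \<Longrightarrow> g \<in> carrier G \<Longrightarrow> \<phi> g ` e = e \<Longrightarrow> x \<in> e \<Longrightarrow> \<phi> g x = x"
    using assms(1) by (auto simp: cellular_action_def)
  interpret group_action G "topspace X" \<phi> by fact
  interpret group G using group_hom group_hom.axioms(1) by blast
  have cover: "\<Union>(cells E) = topspace X" using cw by (simp add: cw_complex_def)
  then obtain e where e: "e \<in> cells E" "x \<in> e" using x by blast
  have eX: "e \<subseteq> topspace X" using e(1) cover by blast
  have coset: "g \<in> (\<lambda>k. h \<otimes> k) ` stabilizer G \<phi> x"
    if g: "g \<in> carrier G" and h: "h \<in> carrier G" and eq: "\<phi> g ` e = \<phi> h ` e" for g h
  proof -
    have k: "inv h \<otimes> g \<in> carrier G" using g h by simp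
    have comp: "\<phi> (inv h) ` \<phi> k ` e = \<phi> (inv h \<otimes> k) ` e" if "k \<in> carrier G" for k
      unfolding image_image
      using eX h that composition_rule[of _ "inv h" k] by (intro image_cong) auto
    have "\<phi> (inv h \<otimes> g) ` e = \<phi> \<one> ` e"
      using comp[OF g] comp[OF h] eq h by simp
    also have "\<dots> = e" using eX by (force simp flip: id_eq_one)
    finally have "\<phi> (inv h \<otimes> g) x = x" using ptw[OF e(1) k _ e(2)] by blast
    then have "inv h \<otimes> g \<in> stabilizer G \<phi> x" using k by (simp add: stabilizer_def)
    moreover have "g = h \<otimes> (inv h \<otimes> g)" using g h by (simp flip: m_assoc)
    ultimately show ?thesis by blast
  qed
  have "finite ((\<lambda>g. \<phi> g ` e) ` carrier G)"
    using bij e(1) by (intro finite_subset[OF _ fin]) (auto simp: bij_betw_def)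
  moreover have "finite {g \<in> carrier G. \<phi> g ` e = c}" if c: "c \<in> (\<lambda>g. \<phi> g ` e) ` carrier G" for c
  proof -
    obtain h where h: "h \<in> carrier G" "c = \<phi> h ` e" using c by blast
    have "{g \<in> carrier G. \<phi> g ` e = c} \<subseteq> (\<lambda>k. h \<otimes> k) ` stabilizer G \<phi> x"
      using coset h by blast
    then show ?thesis using stab finite_surj by blast
  qed
  ultimately have "finite (\<Union>c\<in>(\<lambda>g. \<phi> g ` e) ` carrier G. {g \<in> carrier G. \<phi> g ` e = c})"
    by blast
  then show ?thesis by (rule finite_subset[rotated]) blast
qed

lemma Ncell_imp_finite_group:
  fixes G :: "'g monoid"
  assumes "G \<in> Ncell P3"
  shows "group G \<and> finite (carrier G)"
  using assms
proof (induction rule: Ncell.induct)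
  case (trivial G)
  then show ?case by (simp add: trivial_group_def)
next
  case (action G X E \<phi>)
  then obtain p where cw: "cw_complex X E" and X: "X = nsphere p" by (auto simp: P3_def)
  obtain x where x: "x \<in> topspace X" using in_topspace_nsphere X by blast
  moreover have "finite (cells E)"
    using compact_cw_complex_finite_cells[OF cw] compact_space_nsphere X by simp
  moreover have "finite (stabilizer G \<phi> x)" using action x by auto
  ultimately show ?case using action finite_if_cellular_action[OF _ cw] by blast
qed

theorem proposition3p4:
  shows "(Ncell P3 :: 'g monoid set) = {G. group G \<and> finite (carrier G)}"
  using Ncell_imp_finite_group finite_group_in_Ncell by blast

end
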